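(* Let $(X,r)$ be a set-theoretic solution of the Yang--Baxter equation. Then: (i) there is a unique $1$-cocycle $\pi\colon M(X,r)\to A(X,r)$ with respect to the left action $\lambda'$ such that $\pi(x)=x$ for all $x\in X$; (ii) there is a unique $1$-cocycle $\pi'\colon M(X,r)\to A'(X,r)$ with respect to the right action $\rho'$ such that $\pi'(x)=x$ for all $x\in X$. Furthermore, the mapping $$f\colon M(X,r)\to A(X,r)\rtimes\operatorname{Im}(\lambda'),\quad a\mapsto(\pi(a),\lambda'_a)$$ is a monoid homomorphism, and the mapping $$f'\colon M(X,r)\to A'(X,r)^{op}\rtimes\operatorname{Im}(\rho'),\quad a\mapsto(\pi'(a),\rho'_a)$$ is a monoid anti-homomorphism.
   Context: A set-theoretic solution of the Yang--Baxter equation (YBE) is a pair $(X,r)$ with $X$ a non-empty set (possibly infinite) and $r\colon X\times X\to X\times X$ a map (not necessarily bijective) such that $(r\times \mathrm{id}_X)\circ(\mathrm{id}_X\times r)\circ(r\times \mathrm{id}_X)=(\mathrm{id}_X\times r)\circ(r\times \mathrm{id}_X)\circ(\mathrm{id}_X\times r)$. Write $r(x,y)=(\sigma_x(y),\gamma_y(x))$. The structure monoid is the monoid with presentation $M(X,r)=\langle X\mid x\circ y=\sigma_x(y)\circ\gamma_y(x),\ x,y\in X\rangle$ (operation $\circ$, identity $1$). The left derived structure monoid is $A(X,r)=\langle X\mid x+\sigma_x(y)=\sigma_x(y)+\sigma_{\sigma_x(y)}\gamma_y(x),\ x,y\in X\rangle$ (operation $+$, not necessarily commutative, identity $0$). The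 right derived structure monoid is $A'(X,r)=\langle X\mid \gamma_y(x)\oplus y=\gamma_{\gamma_y(x)}\sigma_x(y)\oplus\gamma_y(x),\ x,y\in X\rangle$ (operation $\oplus$, not necessarily commutative, identity $0'$). $X$ is regarded as a subset of each of these monoids. $\lambda'\colon M(X,r)\to\operatorname{End}(A(X,r))$, $a\mapsto\lambda'_a$, is the unique monoid homomorphism with $\lambda'_x(y)=\sigma_x(y)$ for all $x,y\in X$, and $\rho'\colon M(X,r)\to\operatorname{End}(A'(X,r))$, $a\mapsto\rho'_a$, is the unique monoid anti-homomorphism with $\rho'_x(y)=\gamma_x(y)$ for all $x,y\in X$ (these exist for every set-theoretic solution). A map $\pi\colon M(X,r)\to A(X,r)$ is a $1$-cocycle with respect to $\lambda'$ if $\pi(a\circ b)=\pi(a)+\lambda'_a(\pi(b))$ for all $a,b\in M(X,r)$. A map $\pi'\colon M(X,r)\to A'(X,r)$ is a $1$-cocycle with respect to $\rho'$ if $\pi'(a\circ b)=\rho'_b(\pi'(a))\oplus\pi'(b)$ for all $a,b\in M(X,r)$. For a monoid $B$ and a submonoid $E$ of $\operatorname{End}(B)$, $B\rtimes E$ is the semidirect product with multiplication $(b,g)(c,h)=(b\,g(c),gh)$, where $gh$ is the composition of $h$ followed by $g$. $A'(X,r)^{op}$ is the opposite monoid of $A'(X,r)$. *)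

theory Defs
  imports "HOL-Algebra.Group"
begin

section \<open>Monoid homomorphisms, endomorphism monoids, semidirect products\<close>

text \<open>The library's \<^term>\<open>hom\<close> only asks for compatibility with multiplication; homomorphisms of monoids
  must also preserve the identity.\<close>

definition monoid_hom :: "('a, 'm) monoid_scheme \<Rightarrow> ('b, 'n) monoid_scheme \<Rightarrow> ('a \<Rightarrow> 'b) set" where
  "monoid_hom G H = {h \<in> hom G H. h \<one>\<^bsub>G\<^esub> = \<one>\<^bsub>H\<^esub>}"

definition monoid_antihom :: "('a, 'm) monoid_scheme \<Rightarrow> ('b, 'n) monoid_scheme \<Rightarrow> ('a \<Rightarrow> 'b) set" where
  "monoid_antihom G H = {h \<in> carrier G \<rightarrow> carrier H.
     (\<forall>a\<in>carrier G. \<forall>b\<in>carrier G. h (a \<otimes>\<^bsub>G\<^esub> b) = h b \<otimes>\<^bsub>H\<^esub> h a) \<and> h \<one>\<^bsub>G\<^esub> = \<one>\<^bsub>H\<^esub>}"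

definition op_monoid :: "'a monoid \<Rightarrow> 'a monoid" where
  "op_monoid G = \<lparr>carrier = carrier G, mult = (\<lambda>a b. b \<otimes>\<^bsub>G\<^esub> a), one = \<one>\<^bsub>G\<^esub>\<rparr>"

text \<open>Endomorphisms, like all maps below that are claimed to be unique, are extensional functions, so that
  equality of HOL functions is equality of maps on the carrier.\<close>

definition End_monoid :: "'a monoid \<Rightarrow> ('a \<Rightarrow> 'a) monoid" where
  "End_monoid B = \<lparr>carrier = monoid_hom B B \<inter> extensional (carrier B),
     mult = (\<lambda>g h. compose (carrier B) g h), one = (\<lambda>b\<in>carrier B. b)\<rparr>"

text \<open>Meant for a submonoid \<open>E\<close> of \<open>End_monoid B\<close>.\<close>

definition semidirect :: "'a monoid \<Rightarrow> ('a \<Rightarrow> 'a) set \<Rightarrow> ('a \<times> ('a \<Rightarrow> 'a)) monoid" where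
  "semidirect B E = \<lparr>carrier = carrier B \<times> E,
     mult = (\<lambda>(b, g) (c, h). (b \<otimes>\<^bsub>B\<^esub> g c, g \<otimes>\<^bsub>End_monoid B\<^esub> h)),
     one = (\<one>\<^bsub>B\<^esub>, \<one>\<^bsub>End_monoid B\<^esub>)\<rparr>"


section \<open>Monoids given by a presentation\<close>

text \<open>The congruence on the free monoid \<^term>\<open>lists X\<close> generated by a set \<open>R\<close> of pairs of words.\<close>

inductive_set pres_cong :: "'x set \<Rightarrow> ('x list \<times> 'x list) set \<Rightarrow> ('x list \<times> 'x list) set"
  for X R where
  rel: "(u, v) \<in> R \<Longrightarrow> u \<in> lists X \<Longrightarrow> v \<in> lists X \<Longrightarrow> (u, v) \<in> pres_cong X R"
| refl: "u \<in> lists X \<Longrightarrow> (u, u) \<in> pres_cong X R"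
| sym: "(u, v) \<in> pres_cong X R \<Longrightarrow> (v, u) \<in> pres_cong X R"
| trans: "(u, v) \<in> pres_cong X R \<Longrightarrow> (v, w) \<in> pres_cong X R \<Longrightarrow> (u, w) \<in> pres_cong X R"
| append: "(u, u') \<in> pres_cong X R \<Longrightarrow> (v, v') \<in> pres_cong X R \<Longrightarrow> (u @ v, u' @ v') \<in> pres_cong X R"

definition pres_monoid :: "'x set \<Rightarrow> ('x list \<times> 'x list) set \<Rightarrow> 'x list set monoid" where
  "pres_monoid X R = \<lparr>carrier = lists X // pres_cong X R,
     mult = (\<lambda>a b. \<Union>u\<in>a. \<Union>v\<in>b. pres_cong X R `` {u @ v}),
     one = pres_cong X R `` {[]}\<rparr>"

definition pres_gen :: "'x set \<Rightarrow> ('x list \<times> 'x list) set \<Rightarrow> 'x \<Rightarrow> 'x list set" where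
  "pres_gen X R x = pres_cong X R `` {[x]}"

lemma pres_cong_lists: "(u, v) \<in> pres_cong X R \<Longrightarrow> u \<in> lists X \<and> v \<in> lists X"
  by (induction rule: pres_cong.induct) auto

lemma equiv_pres_cong: "equiv (lists X) (pres_cong X R)"
proof (rule equivI)
  show "pres_cong X R \<subseteq> lists X \<times> lists X" by (auto dest: pres_cong_lists simp del: in_lists_conv_set)
  show "refl_on (lists X) (pres_cong X R)" by (rule refl_onI) (rule pres_cong.refl)
  show "sym (pres_cong X R)" by (rule symI) (rule pres_cong.sym)
  show "trans (pres_cong X R)" by (rule transI) (rule pres_cong.trans)
qed

lemma pres_monoid_mult:
  assumes "u \<in> lists X" "v \<in> lists X"
  shows "pres_cong X R `` {u} \<otimes>\<^bsub>pres_monoid X R\<^esub> pres_cong X R `` {v} = pres_cong X R `` {u @ v}"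
proof -
  have c: "congruent2 (pres_cong X R) (pres_cong X R) (\<lambda>u v. pres_cong X R `` {u @ v})"
    by (auto simp: congruent2_def simp del: Image_singleton_iff
        intro!: equiv_class_eq[OF equiv_pres_cong] pres_cong.append)
  show ?thesis
    using UN_equiv_class2[OF equiv_pres_cong equiv_pres_cong c assms] by (simp add: pres_monoid_def)
qed

lemma monoid_pres_monoid: "monoid (pres_monoid X R)"
proof -
  let ?C = "\<lambda>u. pres_cong X R `` {u}"
  have carr: "carrier (pres_monoid X R) = ?C ` lists X"
    by (auto simp: pres_monoid_def quotient_def)
  have one: "\<one>\<^bsub>pres_monoid X R\<^esub> = ?C []" by (simp add: pres_monoid_def)
  show ?thesis
  proof (rule monoidI; unfold carr one)
    fix a b assume "a \<in> ?C ` lists X" "b \<in> ?C ` lists X"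
    then obtain u v where "a = ?C u" "b = ?C v" "u \<in> lists X" "v \<in> lists X" by blast
    then show "a \<otimes>\<^bsub>pres_monoid X R\<^esub> b \<in> ?C ` lists X"
      using imageI[of "u @ v" "lists X" ?C] by (simp add: pres_monoid_mult)
  next
    fix a b c assume "a \<in> ?C ` lists X" "b \<in> ?C ` lists X" "c \<in> ?C ` lists X"
    then obtain u v w where "a = ?C u" "b = ?C v" "c = ?C w"
      "u \<in> lists X" "v \<in> lists X" "w \<in> lists X" by blast
    then show "a \<otimes>\<^bsub>pres_monoid X R\<^esub> b \<otimes>\<^bsub>pres_monoid X R\<^esub> c =
      a \<otimes>\<^bsub>pres_monoid X R\<^esub> (b \<otimes>\<^bsub>pres_monoid X R\<^esub> c)"
      by (simp add: pres_monoid_mult)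
  next
    fix a assume "a \<in> ?C ` lists X"
    then obtain u where u: "a = ?C u" "u \<in> lists X" by blast
    show "?C [] \<otimes>\<^bsub>pres_monoid X R\<^esub> a = a" "a \<otimes>\<^bsub>pres_monoid X R\<^esub> ?C [] = a"
      unfolding u(1) by (subst pres_monoid_mult; use u in simp)+
  qed (rule imageI, simp)
qed

lemma monoid_End_monoid: "monoid B \<Longrightarrow> monoid (End_monoid B)"
  by (rule monoidI)
    (auto simp: End_monoid_def monoid_hom_def hom_def Pi_iff compose_def extensional_def
      monoid.m_closed monoid.one_closed fun_eq_iff)

lemma monoid_semidirect:
  assumes B: "monoid B" and E: "submonoid E (End_monoid B)"
  shows "monoid (semidirect B E)"
proof -
  interpret B: monoid B by (rule B)
  interpret EB: monoid "End_monoid B" by (rule monoid_End_monoid[OF B])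
  interpret E: submonoid E "End_monoid B" by (rule E)
  have EE: "g \<in> monoid_hom B B" if "g \<in> E" for g
    using that E.subset by (auto simp: End_monoid_def)
  have [simp]: "g c \<in> carrier B" "g (b \<otimes>\<^bsub>B\<^esub> c) = g b \<otimes>\<^bsub>B\<^esub> g c" "g \<one>\<^bsub>B\<^esub> = \<one>\<^bsub>B\<^esub>"
    if "g \<in> E" "c \<in> carrier B" "b \<in> carrier B" for g b c
    using EE[OF that(1)] that(2-) by (auto simp: monoid_hom_def hom_def)
  have [simp]: "(g \<otimes>\<^bsub>End_monoid B\<^esub> h) c = g (h c)" "\<one>\<^bsub>End_monoid B\<^esub> c = c" if "c \<in> carrier B" for g h c
    using that by (auto simp: End_monoid_def compose_def)
  show ?thesis
    by (rule monoidI) (use E.subset in \<open>auto simp: semidirect_def B.m_assoc EB.m_assoc subset_iff\<close>)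
qed


section \<open>Set-theoretic solutions and their structure monoids\<close>

definition r12 :: "('x \<times> 'x \<Rightarrow> 'x \<times> 'x) \<Rightarrow> 'x \<times> 'x \<times> 'x \<Rightarrow> 'x \<times> 'x \<times> 'x" where
  "r12 r = (\<lambda>(x, y, z). (fst (r (x, y)), snd (r (x, y)), z))"

definition r23 :: "('x \<times> 'x \<Rightarrow> 'x \<times> 'x) \<Rightarrow> 'x \<times> 'x \<times> 'x \<Rightarrow> 'x \<times> 'x \<times> 'x" where
  "r23 r = (\<lambda>(x, y, z). (x, r (y, z)))"

definition yb_solution :: "'x set \<Rightarrow> ('x \<times> 'x \<Rightarrow> 'x \<times> 'x) \<Rightarrow> bool" where
  "yb_solution X r \<longleftrightarrow> X \<noteq> {} \<and> r \<in> X \<times> X \<rightarrow> X \<times> X \<and>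
     (\<forall>t\<in>X \<times> X \<times> X. (r12 r \<circ> r23 r \<circ> r12 r) t = (r23 r \<circ> r12 r \<circ> r23 r) t)"

text \<open>\<open>r (x, y) = (sig r x y, gam r y x)\<close>: the index comes first.\<close>

definition sig :: "('x \<times> 'x \<Rightarrow> 'x \<times> 'x) \<Rightarrow> 'x \<Rightarrow> 'x \<Rightarrow> 'x" where
  "sig r x y = fst (r (x, y))"

definition gam :: "('x \<times> 'x \<Rightarrow> 'x \<times> 'x) \<Rightarrow> 'x \<Rightarrow> 'x \<Rightarrow> 'x" where
  "gam r y x = snd (r (x, y))"

definition M_rels :: "'x set \<Rightarrow> ('x \<times> 'x \<Rightarrow> 'x \<times> 'x) \<Rightarrow> ('x list \<times> 'x list) set" where
  "M_rels X r = {([x, y], [sig r x y, gam r y x]) | x y. x \<in> X \<and> y \<in> X}"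

definition A_rels :: "'x set \<Rightarrow> ('x \<times> 'x \<Rightarrow> 'x \<times> 'x) \<Rightarrow> ('x list \<times> 'x list) set" where
  "A_rels X r = {([x, sig r x y], [sig r x y, sig r (sig r x y) (gam r y x)]) | x y. x \<in> X \<and> y \<in> X}"

definition A'_rels :: "'x set \<Rightarrow> ('x \<times> 'x \<Rightarrow> 'x \<times> 'x) \<Rightarrow> ('x list \<times> 'x list) set" where
  "A'_rels X r = {([gam r y x, y], [gam r (gam r y x) (sig r x y), gam r y x]) | x y. x \<in> X \<and> y \<in> X}"

text \<open>The structure monoid and the left and right derived structure monoids, each with its
  map from \<open>X\<close> (in the mathematics, \<open>X\<close> is identified with its image).\<close>

abbreviation "M_mon X r \<equiv> pres_monoid X (M_rels X r)"
abbreviation "M_gen X r \<equiv> pres_gen X (M_rels X r)"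
abbreviation "A_mon X r \<equiv> pres_monoid X (A_rels X r)"
abbreviation "A_gen X r \<equiv> pres_gen X (A_rels X r)"
abbreviation "A'_mon X r \<equiv> pres_monoid X (A'_rels X r)"
abbreviation "A'_gen X r \<equiv> pres_gen X (A'_rels X r)"

definition lam' :: "'x set \<Rightarrow> ('x \<times> 'x \<Rightarrow> 'x \<times> 'x) \<Rightarrow> 'x list set \<Rightarrow> 'x list set \<Rightarrow> 'x list set" where
  "lam' X r = (THE l. l \<in> monoid_hom (M_mon X r) (End_monoid (A_mon X r)) \<and>
     l \<in> extensional (carrier (M_mon X r)) \<and>
     (\<forall>x\<in>X. \<forall>y\<in>X. l (M_gen X r x) (A_gen X r y) = A_gen X r (sig r x y)))"

definition rho' :: "'x set \<Rightarrow> ('x \<times> 'x \<Rightarrow> 'x \<times> 'x) \<Rightarrow> 'x list set \<Rightarrow> 'x list set \<Rightarrow> 'x list set" where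
  "rho' X r = (THE l. l \<in> monoid_antihom (M_mon X r) (End_monoid (A'_mon X r)) \<and>
     l \<in> extensional (carrier (M_mon X r)) \<and>
     (\<forall>x\<in>X. \<forall>y\<in>X. l (M_gen X r x) (A'_gen X r y) = A'_gen X r (gam r x y)))"


section \<open>Cocycles\<close>

definition left_cocycle :: "'a monoid \<Rightarrow> 'b monoid \<Rightarrow> ('a \<Rightarrow> 'b \<Rightarrow> 'b) \<Rightarrow> ('a \<Rightarrow> 'b) \<Rightarrow> bool" where
  "left_cocycle M A l p \<longleftrightarrow> p \<in> carrier M \<rightarrow>\<^sub>E carrier A \<and>
     (\<forall>a\<in>carrier M. \<forall>b\<in>carrier M. p (a \<otimes>\<^bsub>M\<^esub> b) = p a \<otimes>\<^bsub>A\<^esub> l a (p b))"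

definition right_cocycle :: "'a monoid \<Rightarrow> 'b monoid \<Rightarrow> ('a \<Rightarrow> 'b \<Rightarrow> 'b) \<Rightarrow> ('a \<Rightarrow> 'b) \<Rightarrow> bool" where
  "right_cocycle M A l p \<longleftrightarrow> p \<in> carrier M \<rightarrow>\<^sub>E carrier A \<and>
     (\<forall>a\<in>carrier M. \<forall>b\<in>carrier M. p (a \<otimes>\<^bsub>M\<^esub> b) = l b (p a) \<otimes>\<^bsub>A\<^esub> p b)"

end

theory Submission
  imports Defs
begin

text \<open>
  A left \<open>1\<close>-cocycle \<open>\<pi>\<close> for the action \<open>\<lambda>'\<close> is the same thing as a monoid homomorphism
  \<open>a \<mapsto> (\<pi> a, \<lambda>'\<^sub>a)\<close> from \<open>M(X,r)\<close> to the semidirect product of \<open>A(X,r)\<close> with its endomorphism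
  monoid. Both \<open>\<lambda>'\<close> and \<open>\<pi>\<close> therefore come from the universal property of a presentation, used three
  times. The Yang--Baxter equation shows that each \<open>\<sigma>\<^sub>x\<close> respects the relations of \<open>A(X,r)\<close> and
  that \<open>\<sigma>\<^sub>x \<sigma>\<^sub>y = \<sigma>\<^sub>u \<sigma>\<^sub>v\<close> for \<open>(u, v) = r (x, y)\<close>; this gives \<open>\<lambda>'\<close>
  (\<open>sig_extends\<close>, \<open>ex1_left_action\<close>). The elements \<open>(x, \<lambda>'\<^sub>x)\<close> of the semidirect product
  satisfy the relations of \<open>M(X,r)\<close> because the first components satisfy the relations of
  \<open>A(X,r)\<close>; this gives \<open>\<pi>\<close> (\<open>ex_left_cocycle\<close>).

  The one point that is not formal is that a cocycle, which is only assumed to be compatible with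
  products, sends \<open>1\<close> to \<open>0\<close>. The cocycle identity makes \<open>\<pi>(1)\<close> idempotent, and since both sides of
  each defining relation of \<open>A(X,r)\<close> have length two, words have a well-defined length in \<open>A(X,r)\<close>, so
  that \<open>0\<close> is its only idempotent (\<open>idempotent_eq_one\<close>).

  The right-hand statements are the left-hand ones for the flipped solution
  \<open>(x, y) \<mapsto> (\<gamma>\<^sub>x y, \<sigma>\<^sub>y x)\<close>: its structure monoid is \<open>M(X,r)\<^sup>o\<^sup>p\<close> and its left derived monoid is
  \<open>A'(X,r)\<^sup>o\<^sup>p\<close>. For this reason the argument is carried out for any monoids that have the
  required presentations, not just for the monoids of congruence classes of words.
\<close>

section \<open>Monoids with a given presentation\<close>

definition word_val :: "('a, 'm) monoid_scheme \<Rightarrow> ('x \<Rightarrow> 'a) \<Rightarrow> 'x list \<Rightarrow> 'a" where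
  "word_val N f u = foldr (\<lambda>x a. f x \<otimes>\<^bsub>N\<^esub> a) u \<one>\<^bsub>N\<^esub>"

lemma word_val_simps [simp]:
  "word_val N f [] = \<one>\<^bsub>N\<^esub>"
  "word_val N f (x # u) = f x \<otimes>\<^bsub>N\<^esub> word_val N f u"
  by (simp_all add: word_val_def)

lemma word_val_closed:
  assumes "monoid N" "f \<in> X \<rightarrow> carrier N" "u \<in> lists X"
  shows "word_val N f u \<in> carrier N"
  using assms(3)
  by induction (use assms in \<open>auto simp: Pi_iff intro: monoid.m_closed monoid.one_closed\<close>)

lemma word_val_append:
  assumes "monoid N" "f \<in> X \<rightarrow> carrier N" "u \<in> lists X" "v \<in> lists X"
  shows "word_val N f (u @ v) = word_val N f u \<otimes>\<^bsub>N\<^esub> word_val N f v"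
  using assms(3)
proof induction
  case Nil
  show ?case using word_val_closed[OF assms(1,2,4)] by (simp add: monoid.l_one[OF assms(1)])
next
  case (Cons x u)
  have "f x \<in> carrier N" using assms(2) Cons.hyps(1) by auto
  then show ?case
    using Cons.IH word_val_closed[OF assms(1,2)] Cons.hyps(2) assms(4)
    by (simp add: monoid.m_assoc[OF assms(1)])
qed

lemma word_val_hom:
  assumes "h \<in> monoid_hom M N" "monoid M" "f \<in> X \<rightarrow> carrier M" "u \<in> lists X"
  shows "h (word_val M f u) = word_val N (h \<circ> f) u"
  using assms(4)
proof induction
  case Nil
  show ?case using assms(1) by (simp add: monoid_hom_def)
next
  case (Cons x u)
  then have "f x \<in> carrier M" "word_val M f u \<in> carrier M"
    using assms(3) word_val_closed[OF assms(2,3)] by auto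
  then show ?case using assms(1) Cons.IH by (auto simp: monoid_hom_def hom_def)
qed

lemma word_val_cong:
  assumes "u \<in> lists X" "\<And>x. x \<in> X \<Longrightarrow> f x = f' x"
  shows "word_val N f u = word_val N f' u"
  using assms(1) by induction (simp_all add: assms(2))

lemma word_val_respects_pres_cong:
  assumes "monoid N" "f \<in> X \<rightarrow> carrier N"
    and "\<And>u v. (u, v) \<in> R \<Longrightarrow> u \<in> lists X \<Longrightarrow> v \<in> lists X \<Longrightarrow> word_val N f u = word_val N f v"
    and "(u, v) \<in> pres_cong X R"
  shows "word_val N f u = word_val N f v"
  using assms(4)
proof induction
  case (append u u' v v')
  then show ?case
    using pres_cong_lists[OF append.hyps(1)] pres_cong_lists[OF append.hyps(2)]
    by (simp add: word_val_append[OF assms(1,2)])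
qed (use assms(3) in auto)

lemma pres_cong_length:
  assumes "\<And>u v. (u, v) \<in> R \<Longrightarrow> length u = length v" "(u, v) \<in> pres_cong X R"
  shows "length u = length v"
  using assms(2) by induction (auto simp: assms(1))

text \<open>Unlike the concrete monoid of congruence classes, this notion is invariant under isomorphism
  and passes to the opposite monoid.\<close>

locale presented_monoid = monoid M for M (structure) +
  fixes X :: "'x set" and R :: "('x list \<times> 'x list) set" and g :: "'x \<Rightarrow> 'a"
  assumes gen_closed: "g \<in> X \<rightarrow> carrier M"
    and generated: "carrier M = word_val M g ` lists X"
    and word_val_eq_iff:
      "u \<in> lists X \<Longrightarrow> v \<in> lists X \<Longrightarrow> word_val M g u = word_val M g v \<longleftrightarrow> (u, v) \<in> pres_cong X R"
begin

lemma rel_word_val_eq: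
  "(u, v) \<in> R \<Longrightarrow> u \<in> lists X \<Longrightarrow> v \<in> lists X \<Longrightarrow> word_val M g u = word_val M g v"
  using word_val_eq_iff pres_cong.rel by blast

lemma hom_eq_on_carrier:
  assumes "h \<in> monoid_hom M N" "k \<in> monoid_hom M N"
    and "\<And>x. x \<in> X \<Longrightarrow> h (g x) = k (g x)" and "a \<in> carrier M"
  shows "h a = k a"
proof -
  obtain u where u: "u \<in> lists X" "a = word_val M g u" using assms(4) generated by blast
  have "word_val N (h \<circ> g) u = word_val N (k \<circ> g) u"
    using u(1) by (rule word_val_cong) (simp add: assms(3))
  then show ?thesis
    using word_val_hom[OF assms(1) monoid_axioms gen_closed u(1)]
      word_val_hom[OF assms(2) monoid_axioms gen_closed u(1)] u(2) by simp
qed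

lemma extensional_hom_eqI:
  assumes "h \<in> monoid_hom M N" "k \<in> monoid_hom M N"
    and "h \<in> extensional (carrier M)" "k \<in> extensional (carrier M)"
    and "\<And>x. x \<in> X \<Longrightarrow> h (g x) = k (g x)"
  shows "h = k"
  using assms(3,4) hom_eq_on_carrier[OF assms(1,2,5)] by (rule extensionalityI) auto

text \<open>The existence half of the universal property: evaluating any representing word in \<open>N\<close> gives
  a well-defined map.\<close>

lemma ex_hom:
  assumes N: "monoid N" and f: "f \<in> X \<rightarrow> carrier N"
    and R: "\<And>u v. (u, v) \<in> R \<Longrightarrow> u \<in> lists X \<Longrightarrow> v \<in> lists X \<Longrightarrow> word_val N f u = word_val N f v"
  shows "\<exists>h. h \<in> monoid_hom M N \<and> h \<in> extensional (carrier M) \<and> (\<forall>x\<in>X. h (g x) = f x)"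
proof -
  define h where
    "h = (\<lambda>a\<in>carrier M. word_val N f (SOME u. u \<in> lists X \<and> word_val M g u = a))"
  have h: "h (word_val M g u) = word_val N f u" if u: "u \<in> lists X" for u
  proof -
    define v where "v = (SOME v. v \<in> lists X \<and> word_val M g v = word_val M g u)"
    have v: "v \<in> lists X \<and> word_val M g v = word_val M g u"
      unfolding v_def by (rule someI[of _ u]) (use u in blast)
    then have "(v, u) \<in> pres_cong X R" using u word_val_eq_iff by blast
    then have "word_val N f v = word_val N f u"
      using word_val_respects_pres_cong[OF N f R] by blast
    moreover have "word_val M g u \<in> carrier M" using u generated by blast
    ultimately show ?thesis by (simp add: h_def v_def)
  qed
  have "h \<in> hom M N"
  proof (rule homI)
    fix a assume "a \<in> carrier M"
    then obtain u where u: "a = word_val M g u" "u \<in> lists X" using generated by blast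
    then show "h a \<in> carrier N" using h word_val_closed[OF N f] by simp
    fix b assume "b \<in> carrier M"
    then obtain v where v: "b = word_val M g v" "v \<in> lists X" using generated by blast
    have "h (word_val M g (u @ v)) = word_val N f (u @ v)" using u v by (intro h) simp
    then show "h (a \<otimes> b) = h a \<otimes>\<^bsub>N\<^esub> h b"
      by (simp only: u(1) v(1) h u(2) v(2) word_val_append[OF monoid_axioms gen_closed u(2) v(2)]
          word_val_append[OF N f u(2) v(2)])
  qed
  moreover have "h \<one> = \<one>\<^bsub>N\<^esub>" using h[of "[]"] by simp
  moreover have "h (g x) = f x" if "x \<in> X" for x
  proof -
    have "g x \<in> carrier M" "f x \<in> carrier N" using that gen_closed f by auto
    then show ?thesis using h[of "[x]"] that by (simp add: monoid.r_one[OF N])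
  qed
  ultimately show ?thesis unfolding monoid_hom_def h_def by auto
qed

text \<open>Relations between words of equal length give a well-defined word length on the monoid, and
  an idempotent must have length zero.\<close>

lemma idempotent_eq_one:
  assumes R: "\<And>u v. (u, v) \<in> R \<Longrightarrow> length u = length v"
    and "e \<in> carrier M" "e \<otimes> e = e"
  shows "e = \<one>"
proof -
  obtain u where u: "u \<in> lists X" "e = word_val M g u" using assms(2) generated by blast
  have "word_val M g (u @ u) = word_val M g u"
    using assms(3) u by (simp add: word_val_append[OF monoid_axioms gen_closed])
  then have "(u @ u, u) \<in> pres_cong X R"
    using word_val_eq_iff[of "u @ u" u] u(1) by simp
  then have "length (u @ u) = length u" using pres_cong_length[OF R] by blast
  then show ?thesis using u by simp
qed

end

lemma word_val_pres_monoid: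
  "u \<in> lists X \<Longrightarrow> word_val (pres_monoid X R) (pres_gen X R) u = pres_cong X R `` {u}"
proof (induction rule: lists.induct)
  case Nil
  show ?case by (simp add: pres_monoid_def)
next
  case (Cons x u)
  then show ?case using pres_monoid_mult[of "[x]" X u R] by (simp add: pres_gen_def)
qed

lemma presented_pres_monoid: "presented_monoid (pres_monoid X R) X R (pres_gen X R)"
proof -
  interpret monoid "pres_monoid X R" by (rule monoid_pres_monoid)
  show ?thesis
  proof
    show "pres_gen X R \<in> X \<rightarrow> carrier (pres_monoid X R)"
      by (auto simp: pres_gen_def pres_monoid_def intro!: quotientI)
    have "carrier (pres_monoid X R) = (\<lambda>u. pres_cong X R `` {u}) ` lists X"
      by (auto simp: pres_monoid_def quotient_def)
    also have "\<dots> = word_val (pres_monoid X R) (pres_gen X R) ` lists X"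
      by (rule image_cong) (simp_all only: word_val_pres_monoid)
    finally show "carrier (pres_monoid X R) = \<dots>" .
  next
    fix u v assume "u \<in> lists X" "v \<in> lists X"
    then show "word_val (pres_monoid X R) (pres_gen X R) u = word_val (pres_monoid X R) (pres_gen X R) v
      \<longleftrightarrow> (u, v) \<in> pres_cong X R"
      by (simp only: word_val_pres_monoid eq_equiv_class_iff[OF equiv_pres_cong])
  qed
qed


section \<open>Opposite monoids\<close>

lemma op_monoid_simps [simp]:
  "carrier (op_monoid G) = carrier G"
  "a \<otimes>\<^bsub>op_monoid G\<^esub> b = b \<otimes>\<^bsub>G\<^esub> a"
  "\<one>\<^bsub>op_monoid G\<^esub> = \<one>\<^bsub>G\<^esub>"
  by (simp_all add: op_monoid_def)

lemma monoid_op_monoid: "monoid G \<Longrightarrow> monoid (op_monoid G)"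
  by (rule monoidI)
    (simp_all add: monoid.m_closed monoid.m_assoc monoid.one_closed monoid.l_one monoid.r_one)

lemma monoid_antihom_eq_hom_op: "monoid_antihom G H = monoid_hom (op_monoid G) H"
  by (auto simp: monoid_antihom_def monoid_hom_def hom_def)

lemma End_op_monoid: "End_monoid (op_monoid B) = End_monoid B"
proof -
  have "monoid_hom (op_monoid B) (op_monoid B) = monoid_hom B B"
    by (auto simp: monoid_hom_def hom_def)
  then show ?thesis by (simp add: End_monoid_def)
qed

lemma right_cocycle_eq_left_cocycle_op:
  "right_cocycle M A l p \<longleftrightarrow> left_cocycle (op_monoid M) (op_monoid A) l p"
  by (auto simp: right_cocycle_def left_cocycle_def)

lemma word_val_op_monoid:
  assumes "monoid M" "g \<in> X \<rightarrow> carrier M" "u \<in> lists X"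
  shows "word_val (op_monoid M) g u = word_val M g (rev u)"
  using assms(3)
proof induction
  case (Cons x u)
  have "word_val M g (rev u @ [x]) = word_val M g (rev u) \<otimes>\<^bsub>M\<^esub> word_val M g [x]"
    by (rule word_val_append[OF assms(1,2)]) (use Cons.hyps in auto)
  moreover have "g x \<in> carrier M" using assms(2) Cons.hyps by auto
  ultimately show ?case using Cons.IH by (simp add: monoid.r_one[OF assms(1)])
qed simp

lemma pres_cong_rev:
  "(u, v) \<in> pres_cong X R \<Longrightarrow> (rev u, rev v) \<in> pres_cong X (map_prod rev rev ` R)"
proof (induction rule: pres_cong.induct)
  case (rel u v)
  then show ?case by (intro pres_cong.rel) force+
next
  case (append u u' v v')
  then show ?case by (simp add: pres_cong.append)
qed (auto intro: pres_cong.intros)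

lemma pres_cong_rev_iff:
  "(rev u, rev v) \<in> pres_cong X (map_prod rev rev ` R) \<longleftrightarrow> (u, v) \<in> pres_cong X R"
proof
  have "map_prod rev rev ` map_prod rev rev ` R = R" by (force simp: image_image)
  moreover assume "(rev u, rev v) \<in> pres_cong X (map_prod rev rev ` R)"
  ultimately show "(u, v) \<in> pres_cong X R" using pres_cong_rev by fastforce
qed (rule pres_cong_rev)

lemma presented_op_monoid:
  assumes "presented_monoid M X R g"
  shows "presented_monoid (op_monoid M) X (map_prod rev rev ` R) g"
proof -
  interpret presented_monoid M X R g by (rule assms)
  interpret op: monoid "op_monoid M" by (rule monoid_op_monoid) (rule monoid_axioms)
  note val = word_val_op_monoid[OF monoid_axioms gen_closed]
  have lists_rev: "rev ` lists X = lists X"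
  proof (intro equalityI subsetI)
    fix u assume "u \<in> lists X"
    then have "rev u \<in> lists X" by auto
    then show "u \<in> rev ` lists X" by (rule rev_image_eqI) simp
  qed auto
  show ?thesis
  proof
    show "g \<in> X \<rightarrow> carrier (op_monoid M)" using gen_closed by simp
    have "carrier (op_monoid M) = word_val M g ` rev ` lists X"
      by (simp only: lists_rev generated op_monoid_simps)
    also have "\<dots> = word_val (op_monoid M) g ` lists X"
      unfolding image_image by (rule image_cong) (simp_all only: val)
    finally show "carrier (op_monoid M) = \<dots>" .
  next
    fix u v assume uv: "u \<in> lists X" "v \<in> lists X"
    then have "rev u \<in> lists X" "rev v \<in> lists X" by auto
    with uv show "word_val (op_monoid M) g u = word_val (op_monoid M) g v
      \<longleftrightarrow> (u, v) \<in> pres_cong X (map_prod rev rev ` R)"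
      using pres_cong_rev_iff[of "rev u" "rev v" X R] by (simp only: val word_val_eq_iff rev_rev_ident)
  qed
qed


section \<open>Cocycles as homomorphisms to a semidirect product\<close>

lemma End_monoid_mult_apply:
  "c \<in> carrier B \<Longrightarrow> (h \<otimes>\<^bsub>End_monoid B\<^esub> k) c = h (k c)"
  by (simp add: End_monoid_def compose_def)

lemma monoid_semidirect_End:
  assumes "monoid B"
  shows "monoid (semidirect B (carrier (End_monoid B)))"
proof (rule monoid_semidirect[OF assms])
  interpret monoid "End_monoid B" using assms by (rule monoid_End_monoid)
  show "submonoid (carrier (End_monoid B)) (End_monoid B)" by unfold_locales auto
qed

lemma left_cocycle_hom_semidirect:
  assumes "left_cocycle M A l p" "l \<in> monoid_hom M (End_monoid A)" "p \<one>\<^bsub>M\<^esub> = \<one>\<^bsub>A\<^esub>"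
    and "l ` carrier M \<subseteq> E"
  shows "(\<lambda>a. (p a, l a)) \<in> monoid_hom M (semidirect A E)"
  using assms by (auto simp: left_cocycle_def monoid_hom_def hom_def semidirect_def)

lemma hom_semidirect_left_cocycle:
  assumes F: "F \<in> monoid_hom M (semidirect A E)"
    and l: "\<And>a. a \<in> carrier M \<Longrightarrow> snd (F a) = l a" and M: "monoid M"
  shows "left_cocycle M A l (\<lambda>a\<in>carrier M. fst (F a))"
proof -
  have "F a \<in> carrier A \<times> E" if "a \<in> carrier M" for a
    using F that by (auto simp: monoid_hom_def hom_def semidirect_def Pi_iff)
  moreover have "fst (F (a \<otimes>\<^bsub>M\<^esub> b)) = fst (F a) \<otimes>\<^bsub>A\<^esub> l a (fst (F b))"
    if "a \<in> carrier M" "b \<in> carrier M" for a b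
  proof -
    have "F (a \<otimes>\<^bsub>M\<^esub> b) = F a \<otimes>\<^bsub>semidirect A E\<^esub> F b"
      using F that by (simp add: monoid_hom_def hom_def)
    then show ?thesis using l[OF that(1)] by (simp add: semidirect_def split_beta)
  qed
  ultimately show ?thesis
    by (force simp: left_cocycle_def monoid.m_closed[OF M])
qed

lemma snd_hom_semidirect:
  assumes "F \<in> monoid_hom M (semidirect A E)" "E \<subseteq> carrier (End_monoid A)"
  shows "(\<lambda>a. snd (F a)) \<in> monoid_hom M (End_monoid A)"
  using assms by (fastforce simp: monoid_hom_def hom_def semidirect_def split_beta Pi_iff)


section \<open>The left action and its cocycle\<close>

lemma yb_solution_components:
  assumes "yb_solution X r" "x \<in> X" "y \<in> X" "z \<in> X"
  shows sig_sig: "sig r (sig r x y) (sig r (gam r y x) z) = sig r x (sig r y z)"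
    and gam_sig: "gam r (sig r (gam r y x) z) (sig r x y) = sig r (gam r (sig r y z) x) (gam r z y)"
    and gam_gam: "gam r z (gam r y x) = gam r (gam r z y) (gam r (sig r y z) x)"
proof -
  have "(r12 r \<circ> r23 r \<circ> r12 r) (x, y, z) = (r23 r \<circ> r12 r \<circ> r23 r) (x, y, z)"
    using assms unfolding yb_solution_def by blast
  then show "sig r (sig r x y) (sig r (gam r y x) z) = sig r x (sig r y z)"
    "gam r (sig r (gam r y x) z) (sig r x y) = sig r (gam r (sig r y z) x) (gam r z y)"
    "gam r z (gam r y x) = gam r (gam r z y) (gam r (sig r y z) x)"
    by (auto simp: r12_def r23_def sig_def gam_def split_beta prod_eq_iff)
qed

lemma yb_solution_closed:
  assumes "yb_solution X r" "x \<in> X" "y \<in> X"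
  shows "sig r x y \<in> X" "gam r y x \<in> X"
  using assms by (auto simp: yb_solution_def sig_def gam_def Pi_iff mem_Times_iff)

locale structure_monoids =
  M: presented_monoid M X "M_rels X r" g + A: presented_monoid A X "A_rels X r" e
  for M :: "'a monoid" and X :: "'x set" and r g and A :: "'b monoid" and e +
  assumes yb: "yb_solution X r"
begin

lemmas sig_closed = yb_solution_closed(1)[OF yb]
lemmas gam_closed = yb_solution_closed(2)[OF yb]

definition left_action :: "('a \<Rightarrow> 'b \<Rightarrow> 'b) \<Rightarrow> bool" where
  "left_action l \<longleftrightarrow> l \<in> monoid_hom M (End_monoid A) \<and> l \<in> extensional (carrier M) \<and>
     (\<forall>x\<in>X. \<forall>y\<in>X. l (g x) (e y) = e (sig r x y))"

abbreviation gen_cocycle :: "('a \<Rightarrow> 'b \<Rightarrow> 'b) \<Rightarrow> ('a \<Rightarrow> 'b) \<Rightarrow> bool" where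
  "gen_cocycle l p \<equiv> left_cocycle M A l p \<and> (\<forall>x\<in>X. p (g x) = e x)"

lemma e_closed: "x \<in> X \<Longrightarrow> e x \<in> carrier A"
  using A.gen_closed by auto

lemma A_rel:
  assumes "x \<in> X" "y \<in> X"
  shows "e x \<otimes>\<^bsub>A\<^esub> e (sig r x y) = e (sig r x y) \<otimes>\<^bsub>A\<^esub> e (sig r (sig r x y) (gam r y x))"
  using A.rel_word_val_eq[of "[x, sig r x y]" "[sig r x y, sig r (sig r x y) (gam r y x)]"] assms
  by (auto simp: A_rels_def sig_closed gam_closed e_closed)

text \<open>Applied to the relation of \<open>A\<close> for the pair \<open>(y, z)\<close>, the map \<open>\<sigma>\<^sub>x\<close> gives the relation for
  the pair \<open>(\<sigma>\<^sub>x y, \<sigma>\<^sub>w z)\<close> with \<open>w = \<gamma>\<^sub>y x\<close>.\<close>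

lemma sig_extends:
  assumes x: "x \<in> X"
  shows "\<exists>s\<in>carrier (End_monoid A). \<forall>y\<in>X. s (e y) = e (sig r x y)"
proof -
  have "\<exists>s. s \<in> monoid_hom A A \<and> s \<in> extensional (carrier A) \<and> (\<forall>y\<in>X. s (e y) = e (sig r x y))"
  proof (rule A.ex_hom)
    show "(\<lambda>y. e (sig r x y)) \<in> X \<rightarrow> carrier A" using x by (auto intro: e_closed sig_closed)
    fix u v assume "(u, v) \<in> A_rels X r"
    then obtain y z where yz: "y \<in> X" "z \<in> X"
      and uv: "u = [y, sig r y z]" "v = [sig r y z, sig r (sig r y z) (gam r z y)]"
      by (auto simp: A_rels_def)
    define z' where "z' = sig r (gam r y x) z"
    have z': "z' \<in> X" using x yz by (simp add: z'_def sig_closed gam_closed)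
    have 1: "sig r x (sig r y z) = sig r (sig r x y) z'"
      using sig_sig[OF yb x yz] by (simp add: z'_def)
    have "sig r x (sig r (sig r y z) (gam r z y))
        = sig r (sig r x (sig r y z)) (sig r (gam r (sig r y z) x) (gam r z y))"
      using sig_sig[OF yb x, of "sig r y z" "gam r z y"] yz by (simp add: sig_closed gam_closed)
    also have "\<dots> = sig r (sig r (sig r x y) z') (gam r z' (sig r x y))"
      using gam_sig[OF yb x yz] 1 by (simp add: z'_def)
    finally have 2: "sig r x (sig r (sig r y z) (gam r z y)) = \<dots>" .
    show "word_val A (\<lambda>y. e (sig r x y)) u = word_val A (\<lambda>y. e (sig r x y)) v"
      using A_rel[of "sig r x y" z'] x yz z'
      by (simp add: uv 1 2 e_closed sig_closed gam_closed)
  qed unfold_locales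
  then show ?thesis by (auto simp: End_monoid_def)
qed

lemma End_eqI:
  assumes "s \<in> carrier (End_monoid A)" "t \<in> carrier (End_monoid A)"
    and "\<And>y. y \<in> X \<Longrightarrow> s (e y) = t (e y)"
  shows "s = t"
  using assms by (intro A.extensional_hom_eqI) (auto simp: End_monoid_def)

text \<open>The defining relations of \<open>M\<close> hold for the extended maps \<open>\<sigma>\<^sub>x\<close> by the first component of the
  Yang--Baxter equation.\<close>

lemma ex1_left_action: "\<exists>!l. left_action l"
proof -
  interpret E: monoid "End_monoid A" by (rule monoid_End_monoid) (rule A.monoid_axioms)
  obtain s where s: "\<And>x. x \<in> X \<Longrightarrow> s x \<in> carrier (End_monoid A)"
    and se: "\<And>x y. x \<in> X \<Longrightarrow> y \<in> X \<Longrightarrow> s x (e y) = e (sig r x y)"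
    using sig_extends by metis
  have "\<exists>l. l \<in> monoid_hom M (End_monoid A) \<and> l \<in> extensional (carrier M) \<and> (\<forall>x\<in>X. l (g x) = s x)"
  proof (rule M.ex_hom)
    show "s \<in> X \<rightarrow> carrier (End_monoid A)" using s by auto
    fix u v assume "(u, v) \<in> M_rels X r"
    then obtain x y where xy: "x \<in> X" "y \<in> X" and uv: "u = [x, y]" "v = [sig r x y, gam r y x]"
      by (auto simp: M_rels_def)
    have "s x \<otimes>\<^bsub>End_monoid A\<^esub> s y = s (sig r x y) \<otimes>\<^bsub>End_monoid A\<^esub> s (gam r y x)"
      by (rule End_eqI)
        (use xy s in \<open>simp_all add: End_monoid_mult_apply se e_closed sig_closed gam_closed sig_sig[OF yb]\<close>)
    then show "word_val (End_monoid A) s u = word_val (End_monoid A) s v"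
      using xy by (simp add: uv s sig_closed gam_closed)
  qed unfold_locales
  then have "\<exists>l. left_action l" by (metis left_action_def se)
  moreover have "l = k" if "left_action l" "left_action k" for l k
  proof (rule M.extensional_hom_eqI)
    fix x assume x: "x \<in> X"
    then have "g x \<in> carrier M" using M.gen_closed by auto
    then show "l (g x) = k (g x)"
      by (intro End_eqI)
        (use that x in \<open>auto simp: left_action_def monoid_hom_def hom_def Pi_iff\<close>)
  qed (use that in \<open>auto simp: left_action_def\<close>)
  ultimately show ?thesis by blast
qed

text \<open>The cocycle is the first component of the homomorphism \<open>M \<rightarrow> A \<rtimes> End(A)\<close> that extends
  \<open>x \<mapsto> (x, \<lambda>'\<^sub>x)\<close>; the second component is \<open>\<lambda>'\<close> because it agrees with it on generators.\<close>

lemma ex_left_cocycle: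
  assumes l: "left_action l"
  shows "\<exists>p. gen_cocycle l p"
proof -
  let ?S = "semidirect A (carrier (End_monoid A))"
  interpret S: monoid ?S by (rule monoid_semidirect_End) (rule A.monoid_axioms)
  have lh: "l \<in> monoid_hom M (End_monoid A)"
    and lg: "\<And>x y. x \<in> X \<Longrightarrow> y \<in> X \<Longrightarrow> l (g x) (e y) = e (sig r x y)"
    using l by (auto simp: left_action_def)
  have gc: "g x \<in> carrier M" if "x \<in> X" for x using M.gen_closed that by auto
  have lc: "l a \<in> carrier (End_monoid A)" if "a \<in> carrier M" for a
    using lh that by (auto simp: monoid_hom_def hom_def)
  have lm: "l (a \<otimes>\<^bsub>M\<^esub> b) = l a \<otimes>\<^bsub>End_monoid A\<^esub> l b" if "a \<in> carrier M" "b \<in> carrier M" for a b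
    using lh that by (auto simp: monoid_hom_def hom_def)
  define f where "f = (\<lambda>x. (e x, l (g x)))"
  have fc: "f x \<in> carrier ?S" if "x \<in> X" for x
    using that by (simp add: f_def semidirect_def e_closed lc gc)
  have "\<exists>F. F \<in> monoid_hom M ?S \<and> F \<in> extensional (carrier M) \<and> (\<forall>x\<in>X. F (g x) = f x)"
  proof (rule M.ex_hom)
    show "f \<in> X \<rightarrow> carrier ?S" using fc by auto
    fix u v assume "(u, v) \<in> M_rels X r"
    then obtain x y where xy: "x \<in> X" "y \<in> X" and uv: "u = [x, y]" "v = [sig r x y, gam r y x]"
      and "(u, v) \<in> M_rels X r"
      by (auto simp: M_rels_def)
    then have "g x \<otimes>\<^bsub>M\<^esub> g y = g (sig r x y) \<otimes>\<^bsub>M\<^esub> g (gam r y x)"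
      using M.rel_word_val_eq[of u v] by (simp add: gc sig_closed gam_closed)
    then have "l (g x) \<otimes>\<^bsub>End_monoid A\<^esub> l (g y)
        = l (g (sig r x y)) \<otimes>\<^bsub>End_monoid A\<^esub> l (g (gam r y x))"
      using xy by (simp flip: lm add: gc sig_closed gam_closed)
    then have "f x \<otimes>\<^bsub>?S\<^esub> f y = f (sig r x y) \<otimes>\<^bsub>?S\<^esub> f (gam r y x)"
      using xy A_rel[OF xy] by (simp add: f_def semidirect_def lg sig_closed gam_closed)
    then show "word_val ?S f u = word_val ?S f v"
      using xy by (simp add: uv fc sig_closed gam_closed)
  qed unfold_locales
  then obtain F where F: "F \<in> monoid_hom M ?S" and Fg: "\<And>x. x \<in> X \<Longrightarrow> F (g x) = f x" by blast
  have "snd (F a) = l a" if "a \<in> carrier M" for a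
    using M.hom_eq_on_carrier[OF snd_hom_semidirect[OF F] lh _ that] by (simp add: Fg f_def)
  then have "left_cocycle M A l (\<lambda>a\<in>carrier M. fst (F a))"
    using F M.monoid_axioms by (intro hom_semidirect_left_cocycle)
  then show ?thesis using gc by (intro exI conjI ballI) (auto simp: Fg f_def)
qed

lemma left_cocycle_one:
  assumes l: "left_action l" and p: "left_cocycle M A l p"
  shows "p \<one>\<^bsub>M\<^esub> = \<one>\<^bsub>A\<^esub>"
proof (rule A.idempotent_eq_one)
  show p1: "p \<one>\<^bsub>M\<^esub> \<in> carrier A" using p by (auto simp: left_cocycle_def)
  have "l \<one>\<^bsub>M\<^esub> = \<one>\<^bsub>End_monoid A\<^esub>" using l by (simp add: left_action_def monoid_hom_def)
  then have "l \<one>\<^bsub>M\<^esub> (p \<one>\<^bsub>M\<^esub>) = p \<one>\<^bsub>M\<^esub>" using p1 by (simp add: End_monoid_def)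
  moreover have "p (\<one>\<^bsub>M\<^esub> \<otimes>\<^bsub>M\<^esub> \<one>\<^bsub>M\<^esub>) = p \<one>\<^bsub>M\<^esub> \<otimes>\<^bsub>A\<^esub> l \<one>\<^bsub>M\<^esub> (p \<one>\<^bsub>M\<^esub>)"
    using p unfolding left_cocycle_def by blast
  ultimately show "p \<one>\<^bsub>M\<^esub> \<otimes>\<^bsub>A\<^esub> p \<one>\<^bsub>M\<^esub> = p \<one>\<^bsub>M\<^esub>" by simp
qed (auto simp: A_rels_def)

lemma cocycle_hom:
  assumes "left_action l" "left_cocycle M A l p" "l ` carrier M \<subseteq> E"
  shows "(\<lambda>a. (p a, l a)) \<in> monoid_hom M (semidirect A E)"
  using assms left_cocycle_one[OF assms(1,2)]
  by (intro left_cocycle_hom_semidirect) (auto simp: left_action_def)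

lemma ex1_left_cocycle:
  assumes l: "left_action l"
  shows "\<exists>!p. gen_cocycle l p"
proof (rule ex_ex1I)
  show "\<exists>p. gen_cocycle l p" using l by (rule ex_left_cocycle)
  fix p q assume p: "gen_cocycle l p" and q: "gen_cocycle l q"
  show "p = q"
  proof (rule extensionalityI)
    show "p \<in> extensional (carrier M)" "q \<in> extensional (carrier M)"
      using p q by (auto simp: left_cocycle_def PiE_def)
    fix a assume "a \<in> carrier M"
    then have "(p a, l a) = (q a, l a)"
      using M.hom_eq_on_carrier[OF cocycle_hom cocycle_hom, OF l _ subset_refl l _ subset_refl] p q
      by fastforce
    then show "p a = q a" by simp
  qed
qed

text \<open>The definite description has the form in which \<open>\<lambda>'\<close> and \<open>\<rho>'\<close> are defined, the latter after
  reading anti-homomorphisms on \<open>M(X,r)\<close> as homomorphisms on \<open>M(X,r)\<^sup>o\<^sup>p\<close>.\<close>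

lemma cocycle_theorem:
  defines "l \<equiv> (THE l. left_action l)"
  shows "\<exists>!p. gen_cocycle l p"
    and "gen_cocycle l p \<Longrightarrow> (\<lambda>a. (p a, l a)) \<in> monoid_hom M (semidirect A (l ` carrier M))"
proof -
  have l: "left_action l" unfolding l_def using ex1_left_action by (rule theI')
  show "\<exists>!p. gen_cocycle l p" using l by (rule ex1_left_cocycle)
  show "gen_cocycle l p \<Longrightarrow> (\<lambda>a. (p a, l a)) \<in> monoid_hom M (semidirect A (l ` carrier M))"
    using l by (intro cocycle_hom) auto
qed

end


section \<open>The flipped solution\<close>

definition flip_sol :: "('x \<times> 'x \<Rightarrow> 'x \<times> 'x) \<Rightarrow> 'x \<times> 'x \<Rightarrow> 'x \<times> 'x" where
  "flip_sol r = (\<lambda>(x, y). prod.swap (r (y, x)))"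

lemma sig_flip_sol [simp]: "sig (flip_sol r) = gam r"
  and gam_flip_sol [simp]: "gam (flip_sol r) = sig r"
  by (simp_all add: fun_eq_iff sig_def gam_def flip_sol_def)

text \<open>Conjugation with \<open>(x, y, z) \<mapsto> (z, y, x)\<close> exchanges the two sides of the Yang--Baxter equation.\<close>

lemma yb_solution_flip_sol:
  assumes "yb_solution X r"
  shows "yb_solution X (flip_sol r)"
proof -
  have flip: "flip_sol r (x, y) = (gam r x y, sig r y x)" for x y
    by (simp add: flip_sol_def sig_def gam_def prod_eq_iff)
  have "(r12 (flip_sol r) \<circ> r23 (flip_sol r) \<circ> r12 (flip_sol r)) (x, y, z)
      = (r23 (flip_sol r) \<circ> r12 (flip_sol r) \<circ> r23 (flip_sol r)) (x, y, z)"
    if "x \<in> X" "y \<in> X" "z \<in> X" for x y z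
    using yb_solution_components[OF assms that(3,2,1)] by (simp add: r12_def r23_def flip)
  moreover have "flip_sol r \<in> X \<times> X \<rightarrow> X \<times> X"
    using yb_solution_closed[OF assms] by (auto simp: flip)
  ultimately show ?thesis using assms unfolding yb_solution_def by fast
qed

lemma M_rels_flip_sol: "M_rels X (flip_sol r) = map_prod rev rev ` M_rels X r"
  by (force simp: M_rels_def image_iff)

lemma A_rels_flip_sol: "A_rels X (flip_sol r) = map_prod rev rev ` A'_rels X r"
  by (force simp: A_rels_def A'_rels_def image_iff)

theorem proposition3p2:
  fixes X :: "'x set" and r :: "'x \<times> 'x \<Rightarrow> 'x \<times> 'x"
  assumes "yb_solution X r"
  shows "(\<exists>!p. left_cocycle (M_mon X r) (A_mon X r) (lam' X r) p \<and> (\<forall>x\<in>X. p (M_gen X r x) = A_gen X r x))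
    \<and> (\<exists>!p'. right_cocycle (M_mon X r) (A'_mon X r) (rho' X r) p' \<and> (\<forall>x\<in>X. p' (M_gen X r x) = A'_gen X r x))
    \<and> (\<forall>p. left_cocycle (M_mon X r) (A_mon X r) (lam' X r) p \<and> (\<forall>x\<in>X. p (M_gen X r x) = A_gen X r x) \<longrightarrow>
         (\<lambda>a. (p a, lam' X r a))
           \<in> monoid_hom (M_mon X r) (semidirect (A_mon X r) (lam' X r ` carrier (M_mon X r))))
    \<and> (\<forall>p'. right_cocycle (M_mon X r) (A'_mon X r) (rho' X r) p' \<and> (\<forall>x\<in>X. p' (M_gen X r x) = A'_gen X r x) \<longrightarrow>
         (\<lambda>a. (p' a, rho' X r a))
           \<in> monoid_antihom (M_mon X r)
               (semidirect (op_monoid (A'_mon X r)) (rho' X r ` carrier (M_mon X r))))"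
proof -
  interpret left: structure_monoids "M_mon X r" X r "M_gen X r" "A_mon X r" "A_gen X r"
    by (intro structure_monoids.intro structure_monoids_axioms.intro presented_pres_monoid assms)
  interpret right: structure_monoids "op_monoid (M_mon X r)" X "flip_sol r" "M_gen X r"
    "op_monoid (A'_mon X r)" "A'_gen X r"
    by (intro structure_monoids.intro structure_monoids_axioms.intro yb_solution_flip_sol assms)
      (simp_all only: M_rels_flip_sol A_rels_flip_sol presented_op_monoid presented_pres_monoid)
  have lam: "lam' X r = (THE l. left.left_action l)"
    by (simp only: lam'_def left.left_action_def)
  have rho: "rho' X r = (THE l. right.left_action l)"
    by (simp only: rho'_def right.left_action_def monoid_antihom_eq_hom_op End_op_monoid
        sig_flip_sol op_monoid_simps)
  show ?thesis
    using left.cocycle_theorem right.cocycle_theorem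
    unfolding lam rho right_cocycle_eq_left_cocycle_op monoid_antihom_eq_hom_op op_monoid_simps
    by blast
qed

end
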